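(* Let $G$ be a connected graph of order $n$ and diameter $d$, and let $\mu$ be a real number. If $G$ is not a path and $m_G(\mu)=n-d$, then $\mu\in\{0,-1\}$.
   Context: All graphs are finite, simple and undirected. The order $n$ of $G$ is its number of vertices. The diameter $d$ of $G$ is the greatest distance between two vertices of $G$. For a real number $\mu$, $m_G(\mu)$ denotes the multiplicity of $\mu$ as an eigenvalue of the adjacency matrix $A(G)$, with $m_G(\mu)=0$ if $\mu$ is not an eigenvalue; thus $\operatorname{rank}(A(G)-\mu I)+m_G(\mu)=n$. A path of order $k\ge 1$ is a graph isomorphic to $P_k$, with distinct vertices $v_1,\dots,v_k$ and edges $v_1v_2,\dots,v_{k-1}v_k$. *)

theory Defs
  imports
    "Graph_Theory.Graph_Theory"
    "Jordan_Normal_Form.Matrix_Kernel"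
    "Jordan_Normal_Form.Char_Poly"
    "Jordan_Normal_Form.DL_Rank"
begin

text \<open>
  A finite simple undirected graph is a \<^term>\<open>G\<close> with \<^term>\<open>pair_graph G\<close>: finite vertex set,
  and a symmetric, irreflexive arc relation, so that an edge \<open>uv\<close> is the pair of arcs \<open>(u, v)\<close>
  and \<open>(v, u)\<close>.
\<close>

text \<open>Unspecified if \<open>v\<close> is not reachable from \<open>u\<close>; only used for connected graphs.\<close>

definition graph_dist :: "'a pair_pre_digraph \<Rightarrow> 'a \<Rightarrow> 'a \<Rightarrow> nat" where
  "graph_dist G u v = (LEAST k. \<exists>p. pre_digraph.awalk (with_proj G) u p v \<and> length p = k)"

definition diameter :: "'a pair_pre_digraph \<Rightarrow> nat" where
  "diameter G = Max {graph_dist G u v | u v. u \<in> pverts G \<and> v \<in> pverts G}"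

text \<open>Rows and columns are indexed by positions in the vertex enumeration \<open>vs\<close>.\<close>

definition adjacency_mat :: "'a pair_pre_digraph \<Rightarrow> 'a list \<Rightarrow> real mat" where
  "adjacency_mat G vs = mat (length vs) (length vs)
     (\<lambda>(i, j). if (vs ! i, vs ! j) \<in> parcs G then 1 else 0)"

text \<open>
  \<^term>\<open>char_matrix A \<mu>\<close> is \<open>A - \<mu>I\<close>, so this is the dimension of the eigenspace of \<open>\<mu>\<close>, which is
  \<open>0\<close> if \<open>\<mu>\<close> is not an eigenvalue.  For the real symmetric matrices it is applied to, geometric
  and algebraic multiplicity agree.
\<close>

definition eigenvalue_mult :: "real mat \<Rightarrow> real \<Rightarrow> nat" where
  "eigenvalue_mult A \<mu> = kernel_dim (char_matrix A \<mu>)"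

definition path_graph :: "nat \<Rightarrow> nat pair_pre_digraph" where
  "path_graph k = \<lparr> pverts = {1..k},
     parcs = {(i, j). i \<in> {1..k} \<and> j \<in> {1..k} \<and> (j = Suc i \<or> i = Suc j)} \<rparr>"

definition is_path :: "'a pair_pre_digraph \<Rightarrow> bool" where
  "is_path G \<longleftrightarrow> (\<exists>k\<ge>1. digraph_iso (with_proj (path_graph k)) (with_proj G))"

end

theory Submission
  imports Defs
begin

text \<open>
  A diametral path \<open>v\<^sub>0, \<dots>, v\<^sub>d\<close> controls the eigenvectors of \<open>\<mu>\<close>.  If an eigenvector vanishes
  outside \<open>v\<^sub>1, \<dots>, v\<^sub>d\<close>, then the eigenvalue equations at \<open>v\<^sub>0, v\<^sub>1, \<dots>, v\<^bsub>d-1\<^esub>\<close> force, in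
  turn, its values at \<open>v\<^sub>1, \<dots>, v\<^sub>d\<close> to be zero.  So an eigenvector is determined by its values at
  the remaining \<open>n - d\<close> vertices, and \<open>m\<^sub>G(\<mu>) \<le> n - d\<close>.  In the case of equality those \<open>n - d\<close>
  values can be prescribed freely.

  If \<open>G\<close> is not a path, then some vertex \<open>x\<close> off the diametral path is adjacent to it.  Prescribe a
  nonzero value \<open>c\<close> at \<open>x\<close> and zero at all other vertices apart from \<open>v\<^sub>1, \<dots>, v\<^sub>d\<close>.  The equations
  along the path show that the eigenvector vanishes up to the first neighbour \<open>v\<^sub>i\<close> of \<open>x\<close>
  and, for \<open>i < d\<close>, takes the value \<open>-c\<close> at \<open>v\<^bsub>i+1\<^esub>\<close>.  As the path is a geodesic, all its
  vertices adjacent to \<open>x\<close> are among \<open>v\<^sub>i, v\<^bsub>i+1\<^esub>, v\<^bsub>i+2\<^esub>\<close>, and for each of the four possible neighbourhoods the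
  equation at \<open>x\<close> gives \<open>\<mu> = 0\<close> or \<open>\<mu> = -1\<close>: this is \<open>recurrence_with_pendant_term\<close>.

  The passage from multiplicity to eigenvectors with prescribed zeros is
  \<open>eigenfunction_vanishing_on\<close>; diametral paths are provided by \<open>diametral_geodesic\<close>.
\<close>

section \<open>Kernel vectors with prescribed zeros\<close>

text \<open>
  Fewer homogeneous conditions than the dimension of the kernel leave a nonzero solution.  In
  coordinates with respect to a basis of the kernel, the conditions form a square matrix once zero
  rows are added, and its determinant vanishes.
\<close>

lemma mat_kernel_vector_vanishing_on:
  fixes A :: "'f :: field mat"
  assumes A: "A \<in> carrier_mat nr nc"
    and T: "finite T" "T \<subseteq> {..<nc}" "card T < kernel_dim A"
  obtains z where "z \<in> mat_kernel A" "z \<noteq> 0\<^sub>v nc" "\<And>i. i \<in> T \<Longrightarrow> z $ i = 0"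
proof -
  interpret kernel nr nc A by unfold_locales (rule A)
  obtain B where fB: "finite B" and B: "basis B"
    using kernel_basis_exists[OF A] by blast
  have BK: "B \<subseteq> mat_kernel A" and indep: "\<not> Ker.lin_dep B"
    using B by (auto simp: Ker.basis_def)
  obtain bs where bs: "set bs = B" "distinct bs" using finite_distinct_list[OF fB] by blast
  obtain ts where ts: "set ts = T" "distinct ts" using finite_distinct_list[OF T(1)] by blast
  define m where "m = length bs"
  have m: "kernel_dim A = m"
    using Ker.dim_basis[OF fB B] bs by (simp add: m_def distinct_card[symmetric])
  have tm: "length ts < m" using T(3) m ts by (simp add: distinct_card[symmetric])
  define C where "C = mat m m (\<lambda>(r, c). if r < length ts then bs ! c $ (ts ! r) else 0)"
  have C: "C \<in> carrier_mat m m" by (simp add: C_def)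
  have "transpose_mat C *\<^sub>v unit_vec m (m - 1) = 0\<^sub>v m"
    using tm by (intro eq_vecI) (auto simp: C_def)
  moreover have "unit_vec m (m - 1) \<noteq> (0\<^sub>v m :: 'f vec)"
    using tm by (intro unit_vec_nonzero) auto
  moreover have Ct: "transpose_mat C \<in> carrier_mat m m" using C by simp
  ultimately have "det (transpose_mat C) = 0"
    unfolding det_0_iff_vec_prod_zero_field[OF Ct] using unit_vec_carrier by blast
  then have "det C = 0" using det_transpose[OF C] by simp
  then obtain u where u: "u \<in> carrier_vec m" "u \<noteq> 0\<^sub>v m" "C *\<^sub>v u = 0\<^sub>v m"
    using det_0_iff_vec_prod_zero_field[OF C] by blast
  have bij: "bij_betw ((!) bs) {..<m} B" using bs bij_betw_nth by (auto simp: m_def)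
  define a where "a = (\<lambda>b. u $ (the_inv_into {..<m} ((!) bs) b))"
  have a: "a (bs ! c) = u $ c" if "c < m" for c
    using that bij by (simp add: a_def bij_betw_def the_inv_into_f_f)
  define z where "z = lincomb a B"
  have zK: "z \<in> mat_kernel A" unfolding z_def by (rule Ker.lincomb_closed) (use BK in auto)
  have z_index: "z $ i = (\<Sum>c<m. u $ c * bs ! c $ i)" if "i < nc" for i
  proof -
    have "z $ i = (\<Sum>b\<in>B. a b * b $ i)"
      unfolding z_def by (rule lincomb_index[OF that BK])
    also have "\<dots> = (\<Sum>c<m. a (bs ! c) * bs ! c $ i)"
      by (rule sum.reindex_bij_betw[OF bij, symmetric])
    finally show ?thesis by (simp add: a)
  qed
  show ?thesis
  proof (rule that[OF zK])
    show "z \<noteq> 0\<^sub>v nc"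
    proof
      assume z0: "z = 0\<^sub>v nc"
      obtain c where c: "c < m" "u $ c \<noteq> 0"
        using u(1,2) by (metis carrier_vecD eq_vecI index_zero_vec(1) zero_carrier_vec)
      have "bs ! c \<in> B" "a (bs ! c) \<noteq> 0" using c a bs by (auto simp: m_def)
      then have "Ker.lin_dep B"
        unfolding Ker.lin_dep_def using fB z0[unfolded z_def]
        by (intro exI[of _ B] exI[of _ a] exI[of _ "bs ! c"]) auto
      then show False using indep by contradiction
    qed
    fix i assume "i \<in> T"
    then obtain r where r: "r < length ts" "ts ! r = i" using ts by (auto simp: in_set_conv_nth)
    have "0 = (C *\<^sub>v u) $ r" using u(3) r tm by simp
    also have "\<dots> = (\<Sum>c<m. bs ! c $ i * u $ c)"
      using r tm u(1) by (simp add: C_def scalar_prod_def atLeast0LessThan)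
    also have "\<dots> = z $ i" using z_index T(2) \<open>i \<in> T\<close> by (auto simp: mult.commute)
    finally show "z $ i = 0" by simp
  qed
qed

lemma eigenfunction_vanishing_on:
  fixes G :: "'a pair_pre_digraph" and \<mu> :: real
  assumes vs: "distinct vs" and T: "T \<subseteq> set vs"
    and card: "card T < eigenvalue_mult (adjacency_mat G vs) \<mu>"
  obtains w where "\<And>y. y \<in> set vs \<Longrightarrow> (\<Sum>z | z \<in> set vs \<and> (y, z) \<in> parcs G. w z) = \<mu> * w y"
    and "\<And>y. y \<in> T \<Longrightarrow> w y = 0" and "\<exists>y\<in>set vs. w y \<noteq> 0"
proof -
  define n where "n = length vs"
  let ?A = "adjacency_mat G vs"
  let ?M = "char_matrix ?A \<mu>"
  have A: "?A \<in> carrier_mat n n" by (simp add: adjacency_mat_def n_def)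
  then have M: "?M \<in> carrier_mat n n" by simp
  have bij: "bij_betw ((!) vs) {..<n} (set vs)" using vs bij_betw_nth by (auto simp: n_def)
  define pos where "pos = the_inv_into {..<n} ((!) vs)"
  have pos: "pos y < n" "vs ! pos y = y" if "y \<in> set vs" for y
    using that bij the_inv_into_into[of "(!) vs" "{..<n}" y "{..<n}"]
    by (auto simp: pos_def bij_betw_def f_the_inv_into_f)
  have pos_nth: "pos (vs ! i) = i" if "i < n" for i
    using that bij by (simp add: pos_def bij_betw_def the_inv_into_f_f)
  have "inj_on pos T" using T pos by (metis inj_onI subsetD)
  then have "card (pos ` T) < kernel_dim ?M"
    using card by (simp add: card_image eigenvalue_mult_def)
  moreover have "finite (pos ` T)" using T finite_subset by blast
  moreover have "pos ` T \<subseteq> {..<n}" using T pos by auto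
  ultimately obtain z where z: "z \<in> mat_kernel ?M" "z \<noteq> 0\<^sub>v n" "\<And>i. i \<in> pos ` T \<Longrightarrow> z $ i = 0"
    using mat_kernel_vector_vanishing_on[OF M] by metis
  have zc: "z \<in> carrier_vec n" and Mz: "?M *\<^sub>v z = 0\<^sub>v n" using mat_kernelD[OF M z(1)] by auto
  show ?thesis
  proof (rule that[of "\<lambda>y. z $ pos y"])
    fix y assume y: "y \<in> set vs"
    have "?A *\<^sub>v z = \<mu> \<cdot>\<^sub>v z"
    proof -
      have "eigenvector ?A z \<mu>"
        using eigenvector_char_matrix[OF A] zc z(2) Mz by auto
      then show ?thesis by (simp add: eigenvector_def)
    qed
    then have "\<mu> * z $ pos y = (?A *\<^sub>v z) $ pos y" using zc pos[OF y] by simp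
    also have "\<dots> = (\<Sum>i<n. (if (y, vs ! i) \<in> parcs G then 1 else 0) * z $ i)"
      using zc pos[OF y]
      by (simp add: adjacency_mat_def scalar_prod_def atLeast0LessThan n_def cong: if_cong)
    also have "\<dots> = (\<Sum>i<n. if (y, vs ! i) \<in> parcs G then z $ pos (vs ! i) else 0)"
      by (rule sum.cong) (auto simp: pos_nth)
    also have "\<dots> = (\<Sum>x\<in>set vs. if (y, x) \<in> parcs G then z $ pos x else 0)"
      by (rule sum.reindex_bij_betw[OF bij])
    also have "\<dots> = (\<Sum>x | x \<in> set vs \<and> (y, x) \<in> parcs G. z $ pos x)"
      by (simp add: sum.inter_filter)
    finally show "(\<Sum>x | x \<in> set vs \<and> (y, x) \<in> parcs G. z $ pos x) = \<mu> * z $ pos y" by simp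
  next
    show "\<And>y. y \<in> T \<Longrightarrow> z $ pos y = 0" using z(3) by blast
    obtain i where "i < n" "z $ i \<noteq> 0"
      using zc z(2) by (metis carrier_vecD eq_vecI index_zero_vec(1) zero_carrier_vec)
    then show "\<exists>y\<in>set vs. z $ pos y \<noteq> 0" using pos_nth by (metis n_def nth_mem)
  qed
qed

section \<open>Geodesics\<close>

definition geodesic :: "'a pair_pre_digraph \<Rightarrow> (nat \<Rightarrow> 'a) \<Rightarrow> nat \<Rightarrow> bool" where
  "geodesic G v d \<longleftrightarrow>
     (\<forall>i\<le>d. v i \<in> pverts G \<and> graph_dist G (v 0) (v i) = i) \<and>
     (\<forall>i<d. (v i, v (Suc i)) \<in> parcs G)"

context pair_graph
begin

lemma graph_dist_le: "awalk u p w \<Longrightarrow> graph_dist G u w \<le> length p"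
  unfolding graph_dist_def by (intro Least_le) auto

lemma shortest_awalk:
  assumes "awalk u p w"
  obtains q where "awalk u q w" "length q = graph_dist G u w"
proof -
  have "\<exists>q. awalk u q w \<and> length q = graph_dist G u w"
    unfolding graph_dist_def by (rule LeastI_ex) (use assms in auto)
  then show ?thesis using that by blast
qed

lemma graph_dist_arc:
  assumes "awalk u p x" "(x, y) \<in> parcs G"
  shows "graph_dist G u y \<le> Suc (graph_dist G u x)"
proof -
  obtain q where q: "awalk u q x" "length q = graph_dist G u x"
    using shortest_awalk[OF assms(1)] .
  have "awalk x [(x, y)] y" using assms(2) arc_implies_awalk by fastforce
  from graph_dist_le[OF awalk_appendI[OF q(1) this]] q(2) show ?thesis by simp
qed

lemma geodesic_exists:
  assumes "awalk u p w" "graph_dist G u w = d"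
  obtains v where "geodesic G v d"
proof -
  have "\<exists>v. v 0 = u \<and> v d = w \<and> geodesic G v d"
    using assms
  proof (induction d arbitrary: p w)
    case 0
    then obtain q where "awalk u q w" "length q = 0" using shortest_awalk by metis
    then have "u = w" "u \<in> pverts G" by (auto simp: awalk_Nil_iff)
    then show ?case using 0 by (intro exI[of _ "\<lambda>_. u"]) (auto simp: geodesic_def)
  next
    case (Suc d)
    obtain q where q: "awalk u q w" "length q = Suc d" using Suc.prems shortest_awalk by metis
    then obtain r e where qr: "q = r @ [e]" "length r = d" by (metis length_Suc_conv_rev)
    define x where "x = fst e"
    have r: "awalk u r x" and e: "(x, w) \<in> parcs G"
      using q(1) by (auto simp: qr awalk_Cons_iff awalk_Nil_iff x_def)
    have "graph_dist G u x = d"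
      using graph_dist_le[OF r] graph_dist_arc[OF r e] Suc.prems(2) qr(2) by simp
    from Suc.IH[OF r this] obtain v where v: "v 0 = u" "v d = x" "geodesic G v d" by blast
    then show ?case
      using e Suc.prems(2) in_arcsD2[OF e]
      by (intro exI[of _ "v(Suc d := w)"]) (auto simp: geodesic_def le_Suc_eq less_Suc_eq)
  qed
  then show ?thesis using that by blast
qed

lemma diametral_geodesic:
  assumes "strongly_connected G"
  obtains v where "geodesic G v (diameter G)"
proof -
  let ?D = "{graph_dist G u v | u v. u \<in> pverts G \<and> v \<in> pverts G}"
  have "?D = (\<lambda>(u, v). graph_dist G u v) ` (pverts G \<times> pverts G)" by auto
  then have "finite ?D" using pair_finite_verts by simp
  moreover obtain a where "a \<in> pverts G" using assms by (auto simp: strongly_connected_def)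
  then have "?D \<noteq> {}" by blast
  ultimately have "diameter G \<in> ?D" unfolding diameter_def by (rule Max_in)
  then obtain u w where uw: "u \<in> pverts G" "w \<in> pverts G" "graph_dist G u w = diameter G" by auto
  then have "u \<rightarrow>\<^sup>*\<^bsub>with_proj G\<^esub> w" using assms by (auto simp: strongly_connected_def)
  then show ?thesis using geodesic_exists uw(3) that reachable_awalk by blast
qed

text \<open>
  The index of a vertex on a geodesic is its distance from \<open>v 0\<close>, which changes by at most \<open>1\<close> along
  an arc.
\<close>

lemma geodesic_common_neighbour:
  assumes "geodesic G v d" "i \<le> d" "j \<le> d" "(x, v i) \<in> parcs G" "(x, v j) \<in> parcs G"
    and "strongly_connected G"
  shows "j \<le> i + 2"
proof -
  have V: "v 0 \<in> pverts G" using assms(1) by (auto simp: geodesic_def)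
  have reach: "\<exists>p. awalk (v 0) p y" if "y \<in> pverts G" for y
    using that V assms(6) reachable_awalk by (auto simp: strongly_connected_def)
  obtain p where p: "awalk (v 0) p x" using reach in_arcsD1[OF assms(4)] by blast
  obtain q where q: "awalk (v 0) q (v i)" using reach in_arcsD2[OF assms(4)] by blast
  have "graph_dist G (v 0) (v j) \<le> Suc (Suc (graph_dist G (v 0) (v i)))"
    using graph_dist_arc[OF p assms(5)] graph_dist_arc[OF q arcs_symmetric[OF assms(4)]] by simp
  then show ?thesis using assms by (simp add: geodesic_def)
qed

lemma geodesic_arc_iff:
  assumes "geodesic G v d" "i \<le> d" "j \<le> d" and "strongly_connected G"
  shows "(v i, v j) \<in> parcs G \<longleftrightarrow> j = Suc i \<or> i = Suc j"
proof
  have step: "l \<le> Suc k" if "(v k, v l) \<in> parcs G" "k \<le> d" "l \<le> d" for k l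
  proof -
    have "v 0 \<in> pverts G" using assms(1) by (auto simp: geodesic_def)
    then have "v 0 \<rightarrow>\<^sup>*\<^bsub>with_proj G\<^esub> v k"
      using in_arcsD1[OF that(1)] assms(4) by (auto simp: strongly_connected_def)
    then obtain p where "awalk (v 0) p (v k)" using reachable_awalk by blast
    from graph_dist_arc[OF this that(1)] show ?thesis
      using assms(1) that by (simp add: geodesic_def)
  qed
  assume arc: "(v i, v j) \<in> parcs G"
  then have "i \<noteq> j" using no_loops' by blast
  then show "j = Suc i \<or> i = Suc j"
    using step[OF arc assms(2,3)] step[OF arcs_symmetric[OF arc] assms(3,2)] by linarith
next
  assume "j = Suc i \<or> i = Suc j"
  then show "(v i, v j) \<in> parcs G"
    using assms arcs_symmetric by (auto simp: geodesic_def)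
qed

lemma geodesic_inj_on:
  assumes "geodesic G v d"
  shows "inj_on v {..d}"
proof (rule inj_onI)
  fix i j assume "i \<in> {..d}" "j \<in> {..d}" "v i = v j"
  then show "i = j" using assms unfolding geodesic_def by (metis atMost_iff)
qed

lemma is_path_if_geodesic_spanning:
  assumes v: "geodesic G v d" and span: "pverts G = v ` {..d}" and sc: "strongly_connected G"
  shows "is_path G"
proof -
  let ?P = "path_graph (Suc d)"
  define f where "f = (\<lambda>k. v (k - 1))"
  define h where "h = \<lparr>iso_verts = f, iso_arcs = map_prod f f, iso_head = snd, iso_tail = fst\<rparr>"
  have inj: "inj_on f {1..Suc d}"
  proof (rule inj_onI)
    fix i j assume "i \<in> {1..Suc d}" "j \<in> {1..Suc d}" "f i = f j"
    then have "v (i - 1) = v (j - 1)" "i - 1 \<in> {..d}" "j - 1 \<in> {..d}" "1 \<le> i" "1 \<le> j"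
      by (auto simp: f_def)
    then show "i = j" using inj_onD[OF geodesic_inj_on[OF v], of "i - 1" "j - 1"] by linarith
  qed
  have img: "f ` {1..Suc d} = pverts G"
  proof -
    have "(\<lambda>k. k - 1) ` {1..Suc d} = {..d}"
      by (auto simp: image_iff intro!: bexI[of _ "Suc _"])
    then show ?thesis unfolding f_def span by (metis image_image)
  qed
  have P_arcs: "parcs ?P \<subseteq> {1..Suc d} \<times> {1..Suc d}" by (auto simp: path_graph_def)
  have "wf_digraph (with_proj ?P)"
    by (unfold_locales) (auto simp: path_graph_def)
  moreover have "inj_on (map_prod f f) (parcs ?P)"
    using inj_on_subset[OF map_prod_inj_on[OF inj inj] P_arcs] .
  ultimately have iso: "pre_digraph.digraph_isomorphism (with_proj ?P) h"
    using inj by (simp add: pre_digraph.digraph_isomorphism_def h_def path_graph_def)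
  have arc_iff: "(f i, f j) \<in> parcs G \<longleftrightarrow> (i, j) \<in> parcs ?P"
    if "i \<in> {1..Suc d}" "j \<in> {1..Suc d}" for i j
    using that geodesic_arc_iff[OF v _ _ sc, of "i - 1" "j - 1"]
    by (cases i; cases j) (auto simp: f_def path_graph_def)
  have "map_prod f f ` parcs ?P = parcs G"
  proof (intro equalityI subsetI)
    fix e assume "e \<in> map_prod f f ` parcs ?P"
    then obtain i j where "(i, j) \<in> parcs ?P" "e = (f i, f j)" by auto
    then show "e \<in> parcs G" using arc_iff P_arcs by blast
  next
    fix e assume e: "e \<in> parcs G"
    obtain x y where xy: "e = (x, y)" by (cases e)
    have "x \<in> f ` {1..Suc d}" "y \<in> f ` {1..Suc d}" using e xy img in_arcsD1 in_arcsD2 by auto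
    then obtain i j where ij: "i \<in> {1..Suc d}" "j \<in> {1..Suc d}" "x = f i" "y = f j" by blast
    then have "(i, j) \<in> parcs ?P" using arc_iff e xy by blast
    then show "e \<in> map_prod f f ` parcs ?P" using xy ij by force
  qed
  then have "with_proj G = app_iso h (with_proj ?P)"
    using img by (simp add: app_iso_def h_def with_proj_def path_graph_def)
  then show ?thesis
    using iso unfolding is_path_def digraph_iso_def by (intro exI[of _ "Suc d"]) auto
qed

lemma ex_neighbour_outside:
  assumes sc: "strongly_connected G" and S: "S \<subset> pverts G" "S \<noteq> {}"
  obtains s x where "s \<in> S" "x \<in> pverts G - S" "(x, s) \<in> parcs G"
proof -
  obtain a b where ab: "a \<in> S" "b \<in> pverts G" "b \<notin> S" using S by blast
  then have "a \<rightarrow>\<^sup>*\<^bsub>with_proj G\<^esub> b" using sc S by (auto simp: strongly_connected_def)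
  then have "b \<notin> S \<longrightarrow> (\<exists>s\<in>S. \<exists>x\<in>pverts G - S. (s, x) \<in> parcs G)"
  proof (induction rule: reachable_induct)
    case base
    then show ?case using ab by simp
  next
    case (step x y)
    then show ?case using in_arcsD2 by (cases "x \<in> S") auto
  qed
  then show ?thesis using ab that arcs_symmetric by blast
qed

end

section \<open>The eigenvalue equations along a geodesic\<close>

text \<open>
  The values \<open>g j\<close> at the vertices of a geodesic satisfy a three-term recurrence, disturbed by the
  value \<open>c\<close> of an extra vertex at the set \<open>N\<close> of positions adjacent to it.  Until
  the first disturbance the values are zero; for \<open>c = 0\<close> there is none, and all values are zero.
  The truncated \<open>j - 1\<close> is harmless at \<open>j = 0\<close>, where
  the term is \<open>g 0 = 0\<close>.
\<close>

lemma recurrence_zero_until: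
  fixes g :: "nat \<Rightarrow> real"
  assumes g0: "g 0 = 0"
    and rec: "\<And>j. j < d \<Longrightarrow> g (Suc j) + g (j - 1) + (if j \<in> N then c else 0) = \<mu> * g j"
    and i: "i \<le> d" "\<And>j. j < i \<Longrightarrow> j \<in> N \<Longrightarrow> c = 0"
  shows "j \<le> i \<Longrightarrow> g j = 0"
proof (induction j rule: less_induct)
  case (less j)
  show ?case
  proof (cases j)
    case (Suc k)
    then have "g k = 0" "g (k - 1) = 0" using less by auto
    moreover have "(if k \<in> N then c else 0) = 0" using i(2)[of k] less.prems Suc by simp
    ultimately show ?thesis using rec[of k] less.prems Suc i(1) by simp
  qed (simp add: g0)
qed

text \<open>
  Let \<open>i\<close> be the least element of \<open>N\<close>.  Then \<open>g i = 0\<close>, \<open>g (i + 1) = -c\<close> and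
  \<open>g (i + 2) = -\<mu> c\<close>, or \<open>-\<mu> c - c\<close> if \<open>i + 1 \<in> N\<close>, as far as these indices are
  at most \<open>d\<close>.  The equation \<open>sum g N = \<mu> c\<close> at the extra
  vertex becomes \<open>0 = \<mu> c\<close>, \<open>-c = \<mu> c\<close>, \<open>-\<mu> c = \<mu> c\<close> or \<open>-2 c - \<mu> c = \<mu> c\<close> in the cases
  \<open>N = {i}\<close>, \<open>{i, i + 1}\<close>, \<open>{i, i + 2}\<close> and \<open>{i, i + 1, i + 2}\<close>.
\<close>

lemma recurrence_with_pendant_term:
  fixes g :: "nat \<Rightarrow> real"
  assumes g0: "g 0 = 0"
    and rec: "\<And>j. j < d \<Longrightarrow> g (Suc j) + g (j - 1) + (if j \<in> N then c else 0) = \<mu> * g j"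
    and pendant: "sum g N = \<mu> * c"
    and N: "N \<subseteq> {..d}" "N \<noteq> {}" "\<And>i j. i \<in> N \<Longrightarrow> j \<in> N \<Longrightarrow> j \<le> i + 2"
    and nontrivial: "c \<noteq> 0 \<or> (\<exists>j\<le>d. g j \<noteq> 0)"
  shows "\<mu> \<in> {0, -1}"
proof -
  have c: "c \<noteq> 0"
    using recurrence_zero_until[of g d N c \<mu> d, OF g0 rec] nontrivial by auto
  define i where "i = (LEAST i. i \<in> N)"
  have i: "i \<in> N" and i_least: "\<And>j. j \<in> N \<Longrightarrow> i \<le> j"
    using N(2) by (auto simp: i_def intro: LeastI Least_le)
  have id: "i \<le> d" using i N(1) by auto
  have zero: "g j = 0" if "j \<le> i" for j
    by (rule recurrence_zero_until[of g d N c \<mu> i, OF g0 rec id])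
      (use that i_least in \<open>auto dest: leD\<close>)
  have g1: "g (i + 1) = - c" if "i < d" using rec[OF that] i zero by simp
  have g2: "g (i + 2) = - \<mu> * c - (if i + 1 \<in> N then c else 0)" if "i + 1 < d"
    using rec[OF that] g1 zero that by (simp split: if_splits)
  have range: "N \<subseteq> {i, i + 1, i + 2}" using i_least N(3)[OF i] by force
  consider "N = {i}" | "N = {i, i + 1}" | "N = {i, i + 2}" | "N = {i, i + 1, i + 2}"
    using range i by blast
  then show ?thesis
  proof cases
    case 1
    then show ?thesis using pendant zero c by simp
  next
    case 2
    then have "i < d" using N(1) by auto
    then have "- c = \<mu> * c" using 2 pendant zero g1 by simp
    then have "(\<mu> + 1) * c = 0" by (simp add: algebra_simps)
    then show ?thesis using c by simp
  next
    case 3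
    then have "i + 1 < d" using N(1) by auto
    then have "- \<mu> * c = \<mu> * c" using 3 pendant zero g2 by simp
    then show ?thesis using c by simp
  next
    case 4
    then have "i + 1 < d" using N(1) by auto
    then have "- c + (- \<mu> * c - c) = \<mu> * c" using 4 pendant zero g1 g2 by simp
    then have "(\<mu> + 1) * c = 0" by (simp add: algebra_simps)
    then show ?thesis using c by simp
  qed
qed

text \<open>
  The eigenfunction vanishes at \<open>v 0\<close> and off \<open>v 0, \<dots>, v d, x\<close>, so the equations at \<open>v j\<close>
  for \<open>j < d\<close> and at \<open>x\<close> involve only its values along the geodesic and at \<open>x\<close>.
\<close>

lemma (in pair_graph) eigenvalue_of_eigenfunction_near_geodesic:
  fixes w :: "'a \<Rightarrow> real" and \<mu> :: real
  assumes sc: "strongly_connected G" and v: "geodesic G v d"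
    and x: "x \<in> pverts G" "x \<notin> v ` {..d}" and k: "k \<le> d" "(x, v k) \<in> parcs G"
    and eigen: "\<And>y. y \<in> pverts G \<Longrightarrow> (\<Sum>z | z \<in> pverts G \<and> (y, z) \<in> parcs G. w z) = \<mu> * w y"
    and supp: "\<And>y. y \<in> pverts G \<Longrightarrow> y \<notin> insert x (v ` {1..d}) \<Longrightarrow> w y = 0"
    and nonzero: "\<exists>y\<in>pverts G. w y \<noteq> 0"
  shows "\<mu> \<in> {0, -1}"
proof -
  define g where "g = (\<lambda>j. w (v j))"
  have inj: "inj_on v {..d}" using geodesic_inj_on[OF v] .
  have V: "v j \<in> pverts G" if "j \<le> d" for j using v that by (auto simp: geodesic_def)
  have g0: "g 0 = 0"
    unfolding g_def using x inj_on_image_mem_iff[OF inj, of 0 "{1..d}"]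
    by (intro supp) (auto simp: V)
  have off: "w y = 0" if "y \<in> pverts G" "y \<notin> insert x (v ` {..d})" for y
    by (rule supp) (use that in auto)
  have row: "(\<Sum>j | j \<le> d \<and> (y, v j) \<in> parcs G. g j) + (if (y, x) \<in> parcs G then w x else 0) = \<mu> * w y"
    if y: "y \<in> pverts G" for y
  proof -
    let ?e = "\<lambda>z. if (y, z) \<in> parcs G then w z else 0"
    have "\<mu> * w y = (\<Sum>z\<in>pverts G. ?e z)"
      using eigen[OF y] pair_finite_verts by (simp add: sum.inter_filter)
    also have "\<dots> = (\<Sum>z\<in>insert x (v ` {..d}). ?e z)"
      by (rule sum.mono_neutral_right) (use off x V pair_finite_verts in auto)
    also have "\<dots> = ?e x + (\<Sum>z\<in>v ` {..d}. ?e z)" using x by simp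
    also have "(\<Sum>z\<in>v ` {..d}. ?e z) = (\<Sum>j\<in>{..d}. if (y, v j) \<in> parcs G then g j else 0)"
      using sum.reindex[OF inj, of ?e] by (simp add: g_def cong: if_cong)
    also have "\<dots> = (\<Sum>j | j \<le> d \<and> (y, v j) \<in> parcs G. g j)"
      by (simp add: sum.inter_filter[symmetric])
    finally show ?thesis by simp
  qed
  define N where "N = {j. j \<le> d \<and> (x, v j) \<in> parcs G}"
  show ?thesis
  proof (rule recurrence_with_pendant_term[of g d N "w x" \<mu>, OF g0])
    fix j assume j: "j < d"
    have "{l. l \<le> d \<and> (v j, v l) \<in> parcs G} = (if j = 0 then {Suc j} else {Suc j, j - 1})"
      using j geodesic_arc_iff[OF v _ _ sc, of j] by auto
    then have "(\<Sum>l | l \<le> d \<and> (v j, v l) \<in> parcs G. g l) = g (Suc j) + g (j - 1)"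
      using g0 by simp
    moreover have "(v j, x) \<in> parcs G \<longleftrightarrow> j \<in> N"
      using j arcs_symmetric by (auto simp: N_def)
    ultimately show "g (Suc j) + g (j - 1) + (if j \<in> N then w x else 0) = \<mu> * g j"
      using row[OF V, of j] j by (simp add: g_def)
  next
    have "(x, x) \<notin> parcs G" using no_loops' by blast
    then show "sum g N = \<mu> * w x" using row[OF x(1)] by (simp add: N_def)
    show "N \<subseteq> {..d}" "N \<noteq> {}" using k by (auto simp: N_def)
    show "\<And>i j. i \<in> N \<Longrightarrow> j \<in> N \<Longrightarrow> j \<le> i + 2"
      using geodesic_common_neighbour[OF v _ _ _ _ sc] by (auto simp: N_def)
    show "w x \<noteq> 0 \<or> (\<exists>j\<le>d. g j \<noteq> 0)" using nonzero off unfolding g_def by blast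
  qed
qed

theorem theorem1p2:
  fixes G :: "'a pair_pre_digraph" and vs :: "'a list" and n d :: nat and \<mu> :: real
  assumes "pair_graph G"
    and "connected (with_proj G)"
    and "distinct vs" and "set vs = pverts G"
    and "n = card (pverts G)"
    and "d = diameter G"
    and "\<not> is_path G"
    and "int (eigenvalue_mult (adjacency_mat G vs) \<mu>) = int n - int d"
  shows "\<mu> \<in> {0, -1}"
proof -
  interpret pair_graph G by fact
  have sc: "strongly_connected G"
    using symmetric_connected_imp_strongly_connected[OF sym_arcs] assms(2) by simp
  obtain v where v: "geodesic G v d" using diametral_geodesic[OF sc] assms(6) by blast
  have V: "v ` {..d} \<subseteq> pverts G" using v by (auto simp: geodesic_def)
  have inj: "inj_on v {..d}" using geodesic_inj_on[OF v] .
  have "v ` {..d} \<noteq> pverts G" using is_path_if_geodesic_spanning[OF v _ sc] assms(7) by auto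
  with V have "v ` {..d} \<subset> pverts G" by blast
  then obtain s x where "s \<in> v ` {..d}" "x \<in> pverts G - v ` {..d}" "(x, s) \<in> parcs G"
    using ex_neighbour_outside[OF sc] by blast
  then obtain k where k: "k \<le> d" "(x, v k) \<in> parcs G" and x: "x \<in> pverts G" "x \<notin> v ` {..d}"
    by auto
  \<comment> \<open>The starting point \<open>v 0\<close> is not in \<open>?S\<close>, so that \<open>?T\<close> has \<open>n - d - 1\<close> elements and fewer
     than \<open>m\<^sub>G(\<mu>)\<close> zeros are prescribed.\<close>
  let ?S = "insert x (v ` {1..d})"
  let ?T = "pverts G - ?S"
  have S: "?S \<subseteq> pverts G" using V x by auto
  have "card (v ` {1..d}) = d" using card_image[OF inj_on_subset[OF inj]] by auto
  moreover have "x \<notin> v ` {1..d}" using x(2) by auto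
  ultimately have cS: "card ?S = Suc d" by simp
  have "card ?S \<le> n" using S assms(5) pair_finite_verts card_mono by blast
  moreover have "card ?T = n - card ?S"
    using S assms(5) pair_finite_verts by (simp add: card_Diff_subset finite_subset)
  ultimately have "card ?T < eigenvalue_mult (adjacency_mat G vs) \<mu>"
    using assms(8) cS by linarith
  then obtain w where
    "\<And>y. y \<in> pverts G \<Longrightarrow> (\<Sum>z | z \<in> pverts G \<and> (y, z) \<in> parcs G. w z) = \<mu> * w y"
    "\<And>y. y \<in> ?T \<Longrightarrow> w y = 0" "\<exists>y\<in>pverts G. w y \<noteq> 0"
    using eigenfunction_vanishing_on[OF assms(3), of ?T G \<mu>] unfolding assms(4) by blast
  then show ?thesis
    using eigenvalue_of_eigenfunction_near_geodesic[OF sc v x k, of w \<mu>] by blast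
qed

end
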